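(* For every norm $\alpha_0$ on $V$, the metric space $(\mathscr N_{\alpha_0}(V),d_\infty)$ is complete.
   Context: Let $F$ and $E$ be finite extensions of $\mathbb Q_p$, with a fixed (non-Archimedean, nontrivial) absolute value $|\cdot|$ on $E$. Let $\mathbb G$ be a reductive group over $F$ and $G=\mathbb G(F)$. Let $\pi_{\mathrm{sm}}$ be a smooth admissible $E$-representation of $G$, let $\sigma_{\mathrm{alg}}$ be a finite-dimensional algebraic $E$-representation of $\operatorname{Res}_{F/\mathbb Q_p}\mathbb G$ (viewed as a representation of $G$), and put $V=\pi_{\mathrm{sm}}\otimes_E\sigma_{\mathrm{alg}}$ with the diagonal $G$-action. A norm on $V$ is a function $\alpha:V\to\mathbb R_{\ge0}$ with $\alpha(\lambda v)=|\lambda|\alpha(v)$, $\alpha(v+w)\le\max\{\alpha(v),\alpha(w)\}$ for $\lambda\in E$, $v,w\in V$, and $\alpha(v)=0\Rightarrow v=0$. For norms $\alpha,\beta$ put $d_\infty(\alpha,\beta)=\sup_{v\in V\setminus\{0\}}\left|\log\frac{\alpha(v)}{\beta(v)}\right|\in[0,+\infty]$. The finite-distance component of $\alpha_0$ is $\mathscr N_{\alpha_0}(V)=\{\alpha:\ d_\infty(\alpha,\alpha_0)<\infty\}$; $d_\infty$ restricts to a genuine metric on it. *)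

theory Defs
  imports "HOL-Analysis.Analysis" "HOL-Algebra.Algebra" "HOL-Algebra.Algebraic_Closure_Type"
    "HOL-Library.Poly_Mapping"
begin

section \<open>Absolute values and finite extensions of the p-adic numbers\<close>

definition nonarch_abs :: "('k::field \<Rightarrow> real) \<Rightarrow> bool" where
  "nonarch_abs nv \<longleftrightarrow>
     (\<forall>x. 0 \<le> nv x) \<and> (\<forall>x. nv x = 0 \<longleftrightarrow> x = 0) \<and>
     (\<forall>x y. nv (x * y) = nv x * nv y) \<and> (\<forall>x y. nv (x + y) \<le> max (nv x) (nv y))"

definition nontrivial_abs :: "('k::field \<Rightarrow> real) \<Rightarrow> bool" where
  "nontrivial_abs nv \<longleftrightarrow> (\<exists>x. x \<noteq> 0 \<and> nv x \<noteq> 1)"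

definition padic_abs :: "nat \<Rightarrow> rat \<Rightarrow> real" where
  "padic_abs p r = (if r = 0 then 0
     else real p powi (int (multiplicity (int p) (snd (quotient_of r)))
                     - int (multiplicity (int p) (fst (quotient_of r)))))"

text \<open>The field of p-adic numbers enters as a completion of the rationals with respect to the
  p-adic absolute value: the type \<open>'q\<close> with the absolute value \<open>nv\<close> is such a completion.
  Completions are unique up to a unique isometric isomorphism.\<close>

definition padic_numbers :: "nat \<Rightarrow> ('q::field_char_0 \<Rightarrow> real) \<Rightarrow> bool" where
  "padic_numbers p nv \<longleftrightarrow>
     normalization_semidom_class.prime p \<and> nonarch_abs nv \<and>
     (\<forall>r. nv (of_rat r) = padic_abs p r) \<and>
     (\<forall>x. \<forall>\<epsilon>>0. \<exists>r. nv (x - of_rat r) < \<epsilon>) \<and>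
     Metric_space.mcomplete UNIV (\<lambda>x y. nv (x - y))"

definition is_ring_hom :: "('a::comm_ring_1 \<Rightarrow> 'b::comm_ring_1) \<Rightarrow> bool" where
  "is_ring_hom \<phi> \<longleftrightarrow>
     \<phi> 1 = 1 \<and> (\<forall>x y. \<phi> (x + y) = \<phi> x + \<phi> y) \<and> (\<forall>x y. \<phi> (x * y) = \<phi> x * \<phi> y)"

definition finite_dim_subspace ::
    "('k::field \<Rightarrow> 'v::ab_group_add \<Rightarrow> 'v) \<Rightarrow> 'v set \<Rightarrow> bool" where
  "finite_dim_subspace scl U \<longleftrightarrow> (\<exists>B. finite B \<and> U = Modules.module.span scl B)"

definition finite_extension :: "('q::field \<Rightarrow> 'f::field) \<Rightarrow> bool" where
  "finite_extension \<iota> \<longleftrightarrow> is_ring_hom \<iota> \<and> finite_dim_subspace (\<lambda>c x. \<iota> c * x) UNIV"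


section \<open>Tensor products\<close>

definition free_scale :: "'k::field \<Rightarrow> ('x \<Rightarrow>\<^sub>0 'k) \<Rightarrow> ('x \<Rightarrow>\<^sub>0 'k)" where
  "free_scale k = Poly_Mapping.map (\<lambda>c. k * c)"

definition bilinear_relations ::
    "('k::field \<Rightarrow> 'a::ab_group_add \<Rightarrow> 'a) \<Rightarrow> ('k \<Rightarrow> 'b::ab_group_add \<Rightarrow> 'b)
     \<Rightarrow> ('a \<times> 'b \<Rightarrow>\<^sub>0 'k) set" where
  "bilinear_relations sA sB =
     {Poly_Mapping.single (a + a', b) 1 - Poly_Mapping.single (a, b) 1
        - Poly_Mapping.single (a', b) 1 | a a' b. True} \<union>
     {Poly_Mapping.single (a, b + b') 1 - Poly_Mapping.single (a, b) 1
        - Poly_Mapping.single (a, b') 1 | a b b'. True} \<union>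
     {Poly_Mapping.single (sA k a, b) 1 - Poly_Mapping.single (a, b) k | k a b. True} \<union>
     {Poly_Mapping.single (a, sB k b) 1 - Poly_Mapping.single (a, b) k | k a b. True}"

text \<open>\<open>(C, t)\<close> is a tensor product of \<open>A\<close> and \<open>B\<close> if the linear map from the free vector space on
  \<open>A \<times> B\<close> to \<open>C\<close> induced by \<open>t\<close> is onto and its kernel is the subspace of bilinear relations, that
  is, if it identifies \<open>C\<close> with the usual quotient of the free vector space.\<close>

definition tensor_product ::
    "('k::field \<Rightarrow> 'a::ab_group_add \<Rightarrow> 'a) \<Rightarrow> ('k \<Rightarrow> 'b::ab_group_add \<Rightarrow> 'b) \<Rightarrow>
     ('k \<Rightarrow> 'c::ab_group_add \<Rightarrow> 'c) \<Rightarrow> ('a \<Rightarrow> 'b \<Rightarrow> 'c) \<Rightarrow> bool" where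
  "tensor_product sA sB sC t \<longleftrightarrow>
     vector_space sA \<and> vector_space sB \<and> vector_space sC \<and>
     (let ext = (\<lambda>c. \<Sum>x\<in>Poly_Mapping.keys c. sC (Poly_Mapping.lookup c x) (t (fst x) (snd x)))
      in range ext = UNIV \<and>
         {c. ext c = 0} = Modules.module.span free_scale (bilinear_relations sA sB))"

text \<open>The commutative ring \<open>'r\<close> with the homomorphisms \<open>i\<close> and \<open>j\<close> is the tensor product of the
  algebras \<open>'a\<close> and \<open>'b\<close> over the field \<open>'k\<close>.\<close>

definition tensor_algebra ::
    "('k::field \<Rightarrow> 'a::comm_ring_1) \<Rightarrow> ('k \<Rightarrow> 'b::comm_ring_1) \<Rightarrow>
     ('a \<Rightarrow> 'r::comm_ring_1) \<Rightarrow> ('b \<Rightarrow> 'r) \<Rightarrow> bool" where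
  "tensor_algebra \<alpha> \<beta> i j \<longleftrightarrow>
     is_ring_hom i \<and> is_ring_hom j \<and>
     tensor_product (\<lambda>k x. \<alpha> k * x) (\<lambda>k y. \<beta> k * y) (\<lambda>k z. i (\<alpha> k) * z) (\<lambda>x y. i x * j y)"


section \<open>Linear algebraic groups and reductive groups\<close>

text \<open>Polynomials in the matrix entries, and their values at matrices over an algebra with
  structure map \<open>\<phi>\<close>.\<close>

type_synonym ('k, 'n) matrix_poly = "('n \<times> 'n \<Rightarrow>\<^sub>0 nat) \<Rightarrow>\<^sub>0 'k"

definition matrix_poly_eval ::
    "('k::zero \<Rightarrow> 'r::comm_ring_1) \<Rightarrow> ('k, 'n::finite) matrix_poly \<Rightarrow> 'r^'n^'n \<Rightarrow> 'r" where
  "matrix_poly_eval \<phi> f g =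
     (\<Sum>m\<in>Poly_Mapping.keys f. \<phi> (Poly_Mapping.lookup f m) *
        (\<Prod>(i, j)\<in>UNIV. (g $ i $ j) ^ Poly_Mapping.lookup m (i, j)))"

definition GL :: "('r::comm_ring_1^'n^'n) monoid" where
  "GL = \<lparr>carrier = {g. invertible g}, monoid.mult = (**), one = mat 1\<rparr>"

definition group_on :: "('r::comm_ring_1^'n^'n) set \<Rightarrow> ('r^'n^'n) monoid" where
  "group_on H = GL\<lparr>carrier := H\<rparr>"

text \<open>The points, with values in an algebra with structure map \<open>\<phi>\<close>, of the closed subscheme of
  the general linear group cut out by the polynomials in \<open>P\<close>.\<close>

definition points ::
    "('k::zero, 'n::finite) matrix_poly set \<Rightarrow> ('k \<Rightarrow> 'r::comm_ring_1) \<Rightarrow> ('r^'n^'n) set" where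
  "points P \<phi> = {g \<in> carrier GL. \<forall>f\<in>P. matrix_poly_eval \<phi> f g = 0}"

text \<open>A linear algebraic group over \<open>'k\<close> is a Zariski closed subgroup of a general linear group
  given by equations over \<open>'k\<close>. It is described by its points over the algebraic closure. All
  fields used below have characteristic 0, where group schemes are reduced, so nothing is lost.\<close>

definition linear_algebraic_group :: "('k::field, 'n::finite) matrix_poly set \<Rightarrow> bool" where
  "linear_algebraic_group P \<longleftrightarrow> subgroup (points P (to_ac :: 'k \<Rightarrow> 'k alg_closure)) GL"

definition zariski_topology :: "('k::field^'n::finite^'n) topology" where
  "zariski_topology = topology_generated_by {{g. matrix_poly_eval id f g \<noteq> 0} | f. True}"

definition unipotent_matrix :: "'k::field^'n::finite^'n \<Rightarrow> bool" where
  "unipotent_matrix u \<longleftrightarrow> (\<exists>k. (((**) (u - mat 1)) ^^ k) (mat 1) = 0)"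

text \<open>Reductive means that the unipotent radical of the group over the algebraic closure is
  trivial: every Zariski closed connected normal unipotent subgroup is trivial. As with Borel,
  the group itself is not required to be connected.\<close>

definition reductive_group :: "('k::field, 'n::finite) matrix_poly set \<Rightarrow> bool" where
  "reductive_group P \<longleftrightarrow>
     linear_algebraic_group P \<and>
     (let H = points P (to_ac :: 'k \<Rightarrow> 'k alg_closure) in
      \<forall>U. U \<lhd> group_on H \<and>
          closedin (subtopology zariski_topology H) U \<and>
          connectedin zariski_topology U \<and>
          (\<forall>u\<in>U. unipotent_matrix u) \<longrightarrow> U = {mat 1})"


section \<open>Representations\<close>

definition group_representation ::
    "('g, 'm) monoid_scheme \<Rightarrow> ('k::field \<Rightarrow> 'v::ab_group_add \<Rightarrow> 'v) \<Rightarrow> ('g \<Rightarrow> 'v \<Rightarrow> 'v) \<Rightarrow> bool" where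
  "group_representation G scl \<rho> \<longleftrightarrow>
     vector_space scl \<and>
     (\<forall>g\<in>carrier G. Vector_Spaces.linear scl scl (\<rho> g)) \<and>
     (\<forall>v. \<rho> \<one>\<^bsub>G\<^esub> v = v) \<and>
     (\<forall>g\<in>carrier G. \<forall>h\<in>carrier G. \<forall>v. \<rho> (g \<otimes>\<^bsub>G\<^esub> h) v = \<rho> g (\<rho> h v))"

text \<open>The topology on matrices coming from an absolute value on the field of coefficients. On a
  closed subgroup of the general linear group it agrees with the topology of the group of points,
  because inversion is continuous.\<close>

definition matrix_topology :: "('k::field \<Rightarrow> real) \<Rightarrow> ('k^'n::finite^'n) topology" where
  "matrix_topology nv =
     Metric_space.mtopology UNIV (\<lambda>g h. Max (range (\<lambda>(i, j). nv (g $ i $ j - h $ i $ j))))"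

definition smooth_representation ::
    "('g, 'm) monoid_scheme \<Rightarrow> 'g topology \<Rightarrow> ('k::field \<Rightarrow> 'v::ab_group_add \<Rightarrow> 'v) \<Rightarrow>
     ('g \<Rightarrow> 'v \<Rightarrow> 'v) \<Rightarrow> bool" where
  "smooth_representation G T scl \<rho> \<longleftrightarrow>
     group_representation G scl \<rho> \<and> (\<forall>v. openin T {g \<in> carrier G. \<rho> g v = v})"

definition smooth_admissible_representation ::
    "('g, 'm) monoid_scheme \<Rightarrow> 'g topology \<Rightarrow> ('k::field \<Rightarrow> 'v::ab_group_add \<Rightarrow> 'v) \<Rightarrow>
     ('g \<Rightarrow> 'v \<Rightarrow> 'v) \<Rightarrow> bool" where
  "smooth_admissible_representation G T scl \<rho> \<longleftrightarrow>
     smooth_representation G T scl \<rho> \<and>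
     (\<forall>K. subgroup K G \<and> openin T K \<and> compactin T K \<longrightarrow>
          finite_dim_subspace scl {v. \<forall>g\<in>K. \<rho> g v = v})"

text \<open>For a group over \<open>F\<close> cut out by \<open>P\<close>, the points of its Weil restriction from \<open>F\<close> to \<open>Q\<close> over
  the algebraic closure of \<open>E\<close> are \<open>points P i\<close>, where \<open>i\<close> is the map from \<open>F\<close> into the tensor
  product \<open>R\<close> of \<open>F\<close> with the algebraic closure of \<open>E\<close> over \<open>Q\<close>, and \<open>j\<close> below is the map from
  that closure into \<open>R\<close>.

  The regular functions over \<open>E\<close> on the Weil restriction are generated by the coordinates, over
  \<open>Q\<close>, of the entries of \<open>g\<close> and of the inverse of \<open>g\<close>. A coordinate is the base change \<open>l\<close> to the
  closure of \<open>E\<close> of a \<open>Q\<close>-linear functional on \<open>F\<close>.\<close>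

definition weil_coordinate ::
    "('q::field \<Rightarrow> 'e::field) \<Rightarrow> ('f::field \<Rightarrow> 'r::comm_ring_1) \<Rightarrow> ('e alg_closure \<Rightarrow> 'r) \<Rightarrow>
     ('r \<Rightarrow> 'e alg_closure) \<Rightarrow> bool" where
  "weil_coordinate \<iota>E i j l \<longleftrightarrow>
     (\<forall>x y. l (x + y) = l x + l y) \<and> (\<forall>c x. l (j c * x) = c * l x) \<and>
     (\<forall>x. l (i x) \<in> range (\<lambda>q. to_ac (\<iota>E q)))"

inductive_set weil_regular_functions ::
    "('q::field \<Rightarrow> 'e::field) \<Rightarrow> ('f::field \<Rightarrow> 'r::comm_ring_1) \<Rightarrow> ('e alg_closure \<Rightarrow> 'r) \<Rightarrow>
     ('r^'n::finite^'n \<Rightarrow> 'e alg_closure) set"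
  for \<iota>E :: "'q \<Rightarrow> 'e" and i :: "'f \<Rightarrow> 'r" and j :: "'e alg_closure \<Rightarrow> 'r" where
    const: "(\<lambda>g. to_ac c) \<in> weil_regular_functions \<iota>E i j"
  | entry: "weil_coordinate \<iota>E i j l \<Longrightarrow> (\<lambda>g. l (g $ a $ b)) \<in> weil_regular_functions \<iota>E i j"
  | inv_entry: "weil_coordinate \<iota>E i j l \<Longrightarrow>
      (\<lambda>g. l (matrix_inv g $ a $ b)) \<in> weil_regular_functions \<iota>E i j"
  | add: "u \<in> weil_regular_functions \<iota>E i j \<Longrightarrow> v \<in> weil_regular_functions \<iota>E i j \<Longrightarrow>
      (\<lambda>g. u g + v g) \<in> weil_regular_functions \<iota>E i j"
  | mult: "u \<in> weil_regular_functions \<iota>E i j \<Longrightarrow> v \<in> weil_regular_functions \<iota>E i j \<Longrightarrow>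
      (\<lambda>g. u g * v g) \<in> weil_regular_functions \<iota>E i j"

text \<open>A finite-dimensional algebraic \<open>E\<close>-representation of the Weil restriction is, in a basis
  \<open>B\<close>, a square matrix \<open>A\<close> of regular functions over \<open>E\<close> which is a homomorphism on points over
  the algebraic closure. The representation \<open>\<rho>\<close> of the group of \<open>F\<close>-points is obtained by evaluating
  \<open>A\<close> at the images of \<open>F\<close>-points, where the entries of \<open>A\<close> take values in \<open>E\<close>.\<close>

definition algebraic_weil_representation ::
    "('q::field \<Rightarrow> 'e::field) \<Rightarrow> ('f::field \<Rightarrow> 'r::comm_ring_1) \<Rightarrow> ('e alg_closure \<Rightarrow> 'r) \<Rightarrow>
     ('f, 'n::finite) matrix_poly set \<Rightarrow> ('e \<Rightarrow> 's::ab_group_add \<Rightarrow> 's) \<Rightarrow>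
     ('f^'n^'n \<Rightarrow> 's \<Rightarrow> 's) \<Rightarrow> bool" where
  "algebraic_weil_representation \<iota>E i j P scl \<rho> \<longleftrightarrow>
     group_representation (group_on (points P id)) scl \<rho> \<and>
     (\<exists>B A. finite B \<and> \<not> Modules.module.dependent scl B \<and> Modules.module.span scl B = UNIV \<and>
        (\<forall>b\<in>B. \<forall>c\<in>B. A b c \<in> weil_regular_functions \<iota>E i j) \<and>
        (\<forall>b\<in>B. \<forall>c\<in>B. A b c (mat 1) = (if b = c then 1 else 0)) \<and>
        (\<forall>g\<in>points P i. \<forall>h\<in>points P i. \<forall>b\<in>B. \<forall>c\<in>B.
           A b c (g ** h) = (\<Sum>d\<in>B. A b d g * A d c h)) \<and>
        (\<forall>g\<in>points P id. \<forall>c\<in>B. \<exists>k.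
           (\<forall>b\<in>B. to_ac (k b) = A b c (map_matrix i g)) \<and>
           \<rho> g c = (\<Sum>b\<in>B. scl (k b) b)))"


section \<open>Norms\<close>

definition is_norm ::
    "('e::field \<Rightarrow> real) \<Rightarrow> ('e \<Rightarrow> 'v::ab_group_add \<Rightarrow> 'v) \<Rightarrow> ('v \<Rightarrow> real) \<Rightarrow> bool" where
  "is_norm absE scl \<alpha> \<longleftrightarrow>
     (\<forall>v. 0 \<le> \<alpha> v) \<and>
     (\<forall>c v. \<alpha> (scl c v) = absE c * \<alpha> v) \<and>
     (\<forall>v w. \<alpha> (v + w) \<le> max (\<alpha> v) (\<alpha> w)) \<and>
     (\<forall>v. \<alpha> v = 0 \<longrightarrow> v = 0)"

definition d_infty :: "('v::ab_group_add \<Rightarrow> real) \<Rightarrow> ('v \<Rightarrow> real) \<Rightarrow> ennreal" where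
  "d_infty \<alpha> \<beta> = (SUP v\<in>UNIV - {0}. ennreal \<bar>ln (\<alpha> v / \<beta> v)\<bar>)"

definition finite_distance_component ::
    "('e::field \<Rightarrow> real) \<Rightarrow> ('e \<Rightarrow> 'v::ab_group_add \<Rightarrow> 'v) \<Rightarrow> ('v \<Rightarrow> real) \<Rightarrow> ('v \<Rightarrow> real) set" where
  "finite_distance_component absE scl \<alpha>0 = {\<alpha>. is_norm absE scl \<alpha> \<and> d_infty \<alpha> \<alpha>0 < \<infinity>}"

end

theory Submission
  imports Defs
begin

text \<open>
  Passing to logarithms identifies a norm \<open>\<alpha>\<close> with the real function \<open>ln \<circ> \<alpha>\<close> on the nonzero
  vectors, and under this identification \<open>d_infty\<close> is the distance of uniform convergence
  (\<open>d_infty_eq_SUP_diff\<close>). So \<open>d_infty\<close> is an extended metric on all norms, and the norms at finite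
  distance from a given one form a metric space (\<open>Metric_space_component\<close>).

  Completeness of the component combines completeness of the real functions under the uniform
  distance with the fact that the norms form a closed subset
  (\<open>uniformly_Cauchy_norms_converge\<close>). For a Cauchy sequence of norms \<open>\<sigma>\<close> the numbers
  \<open>ln (\<sigma> n v)\<close> converge at every nonzero \<open>v\<close>, so \<open>\<sigma> n v\<close> converges to a positive real number:
  this is where definiteness of the limit comes from. Homogeneity and the ultrametric inequality
  are an equality and a weak inequality between values at finitely many vectors, so they survive
  pointwise limits (\<open>is_norm_pointwise_limit\<close>).
\<close>

text \<open>Symmetry holds for all functions, as \<open>Metric_space\<close> demands: at a zero of \<open>\<alpha>\<close> or \<open>\<beta>\<close> both
  quotients are 0, and at negative values \<open>ln\<close> is still odd under inversion.\<close>

lemma d_infty_commute: "d_infty \<alpha> \<beta> = d_infty \<beta> \<alpha>"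
proof -
  have "\<bar>ln (\<alpha> v / \<beta> v)\<bar> = \<bar>ln (\<beta> v / \<alpha> v)\<bar>" for v
    using ln_inverse[of "\<alpha> v / \<beta> v"] by (simp add: inverse_divide)
  then show ?thesis by (simp add: d_infty_def)
qed

locale nonarch_vector_space = vector_space scl
  for scl :: "'e::field \<Rightarrow> 'v::ab_group_add \<Rightarrow> 'v" +
  fixes absE :: "'e \<Rightarrow> real"
  assumes nonarch: "nonarch_abs absE"
begin

lemma norm_zero:
  assumes "is_norm absE scl \<alpha>"
  shows "\<alpha> 0 = 0"
proof -
  have "\<alpha> (scl 0 0) = absE 0 * \<alpha> 0" using assms unfolding is_norm_def by blast
  moreover have "absE 0 = 0" using nonarch unfolding nonarch_abs_def by blast
  ultimately show ?thesis by simp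
qed

lemma norm_pos:
  assumes "is_norm absE scl \<alpha>" "v \<noteq> 0"
  shows "\<alpha> v > 0"
  using assms unfolding is_norm_def by (metis less_le)

lemma d_infty_eq_SUP_diff:
  assumes "is_norm absE scl \<alpha>" "is_norm absE scl \<beta>"
  shows "d_infty \<alpha> \<beta> = (SUP v\<in>UNIV - {0}. ennreal \<bar>ln (\<alpha> v) - ln (\<beta> v)\<bar>)"
  unfolding d_infty_def
proof (rule SUP_cong)
  fix v :: 'v assume "v \<in> UNIV - {0}"
  then have "\<alpha> v > 0" "\<beta> v > 0" using norm_pos assms by auto
  then show "ennreal \<bar>ln (\<alpha> v / \<beta> v)\<bar> = ennreal \<bar>ln (\<alpha> v) - ln (\<beta> v)\<bar>"
    by (simp add: ln_div)
qed simp

lemma d_infty_le_iff: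
  assumes "is_norm absE scl \<alpha>" "is_norm absE scl \<beta>" "0 \<le> c"
  shows "d_infty \<alpha> \<beta> \<le> ennreal c \<longleftrightarrow> (\<forall>v. v \<noteq> 0 \<longrightarrow> \<bar>ln (\<alpha> v) - ln (\<beta> v)\<bar> \<le> c)"
  using assms(3) by (auto simp: d_infty_eq_SUP_diff[OF assms(1,2)] SUP_le_iff)

lemma ln_diff_le_d_infty:
  assumes "is_norm absE scl \<alpha>" "is_norm absE scl \<beta>" "v \<noteq> 0"
  shows "ennreal \<bar>ln (\<alpha> v) - ln (\<beta> v)\<bar> \<le> d_infty \<alpha> \<beta>"
  unfolding d_infty_eq_SUP_diff[OF assms(1,2)] using assms(3) by (intro SUP_upper) auto

lemma d_infty_triangle:
  assumes "is_norm absE scl \<alpha>" "is_norm absE scl \<beta>" "is_norm absE scl \<gamma>"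
  shows "d_infty \<alpha> \<gamma> \<le> d_infty \<alpha> \<beta> + d_infty \<beta> \<gamma>"
  unfolding d_infty_eq_SUP_diff[OF assms(1,3)]
proof (rule SUP_least)
  fix v :: 'v assume "v \<in> UNIV - {0}"
  then have v: "v \<noteq> 0" by simp
  have "ennreal \<bar>ln (\<alpha> v) - ln (\<gamma> v)\<bar>
      \<le> ennreal (\<bar>ln (\<alpha> v) - ln (\<beta> v)\<bar> + \<bar>ln (\<beta> v) - ln (\<gamma> v)\<bar>)"
    by (intro ennreal_leI) linarith
  also have "\<dots> = ennreal \<bar>ln (\<alpha> v) - ln (\<beta> v)\<bar> + ennreal \<bar>ln (\<beta> v) - ln (\<gamma> v)\<bar>"
    by simp
  also have "\<dots> \<le> d_infty \<alpha> \<beta> + d_infty \<beta> \<gamma>"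
    by (intro add_mono ln_diff_le_d_infty assms v)
  finally show "ennreal \<bar>ln (\<alpha> v) - ln (\<gamma> v)\<bar> \<le> d_infty \<alpha> \<beta> + d_infty \<beta> \<gamma>" .
qed

lemma d_infty_eq_0_iff:
  assumes "is_norm absE scl \<alpha>" "is_norm absE scl \<beta>"
  shows "d_infty \<alpha> \<beta> = 0 \<longleftrightarrow> \<alpha> = \<beta>"
proof
  assume "d_infty \<alpha> \<beta> = 0"
  then have ln_eq: "\<bar>ln (\<alpha> v) - ln (\<beta> v)\<bar> \<le> 0" if "v \<noteq> 0" for v
    using d_infty_le_iff[OF assms, of 0] that by simp
  have "\<alpha> v = \<beta> v" for v
  proof (cases "v = 0")
    case False
    then show ?thesis
      using ln_eq[of v] norm_pos[OF assms(1), of v] norm_pos[OF assms(2), of v] by simp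
  qed (simp add: norm_zero assms)
  then show "\<alpha> = \<beta>" by blast
next
  assume "\<alpha> = \<beta>"
  then show "d_infty \<alpha> \<beta> = 0"
    using d_infty_le_iff[OF assms, of 0] by simp
qed

lemma d_infty_finite_in_component:
  assumes "is_norm absE scl \<alpha>0"
    and "\<alpha> \<in> finite_distance_component absE scl \<alpha>0"
    and "\<beta> \<in> finite_distance_component absE scl \<alpha>0"
  shows "d_infty \<alpha> \<beta> < \<infinity>"
proof -
  have norms: "is_norm absE scl \<alpha>" "is_norm absE scl \<beta>"
    and finite: "d_infty \<alpha> \<alpha>0 < \<infinity>" "d_infty \<beta> \<alpha>0 < \<infinity>"
    using assms by (auto simp: finite_distance_component_def)
  have "d_infty \<alpha> \<beta> \<le> d_infty \<alpha> \<alpha>0 + d_infty \<alpha>0 \<beta>"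
    by (rule d_infty_triangle[OF norms(1) assms(1) norms(2)])
  also have "\<dots> < \<infinity>"
    using finite d_infty_commute[of \<alpha>0 \<beta>] by simp
  finally show ?thesis .
qed

lemma Metric_space_component:
  assumes "is_norm absE scl \<alpha>0"
  shows "Metric_space (finite_distance_component absE scl \<alpha>0) (\<lambda>\<alpha> \<beta>. enn2real (d_infty \<alpha> \<beta>))"
    (is "Metric_space ?M ?d")
proof
  have norm: "is_norm absE scl \<alpha>" if "\<alpha> \<in> ?M" for \<alpha>
    using that by (simp add: finite_distance_component_def)
  note finite = d_infty_finite_in_component[OF assms]
  show "0 \<le> ?d \<alpha> \<beta>" for \<alpha> \<beta> by simp
  show "?d \<alpha> \<beta> = ?d \<beta> \<alpha>" for \<alpha> \<beta> by (simp add: d_infty_commute)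
  show "?d \<alpha> \<beta> = 0 \<longleftrightarrow> \<alpha> = \<beta>" if "\<alpha> \<in> ?M" "\<beta> \<in> ?M" for \<alpha> \<beta>
    using that finite[OF that] d_infty_eq_0_iff[OF norm norm, of \<alpha> \<beta>]
    by (auto simp: enn2real_eq_0_iff)
  show "?d \<alpha> \<gamma> \<le> ?d \<alpha> \<beta> + ?d \<beta> \<gamma>" if "\<alpha> \<in> ?M" "\<beta> \<in> ?M" "\<gamma> \<in> ?M" for \<alpha> \<beta> \<gamma>
  proof -
    have "?d \<alpha> \<gamma> \<le> enn2real (d_infty \<alpha> \<beta> + d_infty \<beta> \<gamma>)"
      using that finite by (intro enn2real_mono d_infty_triangle norm) auto
    also have "\<dots> = ?d \<alpha> \<beta> + ?d \<beta> \<gamma>"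
      using that finite by (intro enn2real_plus) auto
    finally show ?thesis .
  qed
qed

text \<open>Positivity of the limit away from 0 has to be assumed: a pointwise limit of norms is in
  general only a seminorm.\<close>

lemma is_norm_pointwise_limit:
  assumes norms: "\<And>n. is_norm absE scl (\<sigma> n)"
    and lim: "\<And>v. (\<lambda>n. \<sigma> n v) \<longlonglongrightarrow> \<alpha> v"
    and pos: "\<And>v. v \<noteq> 0 \<Longrightarrow> \<alpha> v > 0"
  shows "is_norm absE scl \<alpha>"
  unfolding is_norm_def
proof (intro conjI allI impI)
  fix v w :: 'v and c :: 'e
  have nonneg: "0 \<le> \<sigma> n v" and scale: "\<sigma> n (scl c v) = absE c * \<sigma> n v"
    and ultra: "\<sigma> n (v + w) \<le> max (\<sigma> n v) (\<sigma> n w)" for n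
    using norms[of n] unfolding is_norm_def by blast+
  show "0 \<le> \<alpha> v"
    using nonneg by (intro LIMSEQ_le_const[OF lim]) auto
  have "(\<lambda>n. \<sigma> n (scl c v)) \<longlonglongrightarrow> absE c * \<alpha> v"
    unfolding scale by (intro tendsto_intros lim)
  then show "\<alpha> (scl c v) = absE c * \<alpha> v"
    using lim LIMSEQ_unique by blast
  show "\<alpha> (v + w) \<le> max (\<alpha> v) (\<alpha> w)"
    using ultra by (intro LIMSEQ_le[OF lim tendsto_max[OF lim lim]]) auto
  show "v = 0" if "\<alpha> v = 0" using that pos[of v] by force
qed

text \<open>The Cauchy condition is uniform in \<open>v\<close>: letting the second index tend to infinity in
  \<open>\<bar>ln (\<sigma> n v) - ln (\<sigma> m v)\<bar> \<le> \<epsilon>\<close> gives the same bound between \<open>\<sigma> n\<close> and the pointwise limit.\<close>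

lemma uniformly_Cauchy_norms_converge:
  fixes \<sigma> :: "nat \<Rightarrow> 'v \<Rightarrow> real"
  assumes norms: "\<And>n. is_norm absE scl (\<sigma> n)"
    and cauchy: "\<And>\<epsilon>. \<epsilon> > 0 \<Longrightarrow> \<exists>N. \<forall>n\<ge>N. \<forall>m\<ge>N. d_infty (\<sigma> n) (\<sigma> m) \<le> ennreal \<epsilon>"
  obtains \<alpha> where "is_norm absE scl \<alpha>"
    and "\<And>\<epsilon>. \<epsilon> > 0 \<Longrightarrow> \<exists>N. \<forall>n\<ge>N. d_infty (\<sigma> n) \<alpha> \<le> ennreal \<epsilon>"
proof -
  have ln_cauchy: "\<exists>N. \<forall>n\<ge>N. \<forall>m\<ge>N. \<forall>v. v \<noteq> 0 \<longrightarrow> \<bar>ln (\<sigma> n v) - ln (\<sigma> m v)\<bar> \<le> \<epsilon>"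
    if "\<epsilon> > 0" for \<epsilon>
    using cauchy[OF that] d_infty_le_iff[OF norms norms, of \<epsilon>] that by simp
  have "Cauchy (\<lambda>n. ln (\<sigma> n v))" if "v \<noteq> 0" for v
  proof (rule metric_CauchyI)
    fix \<epsilon> :: real assume "\<epsilon> > 0"
    then obtain N where "\<forall>n\<ge>N. \<forall>m\<ge>N. \<forall>v. v \<noteq> 0 \<longrightarrow> \<bar>ln (\<sigma> n v) - ln (\<sigma> m v)\<bar> \<le> \<epsilon> / 2"
      using ln_cauchy[of "\<epsilon> / 2"] by auto
    then have "\<forall>m\<ge>N. \<forall>n\<ge>N. \<bar>ln (\<sigma> m v) - ln (\<sigma> n v)\<bar> \<le> \<epsilon> / 2" using that by blast
    then show "\<exists>N. \<forall>m\<ge>N. \<forall>n\<ge>N. dist (ln (\<sigma> m v)) (ln (\<sigma> n v)) < \<epsilon>"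
      using \<open>\<epsilon> > 0\<close> by (intro exI[of _ N]) (force simp: dist_real_def)
  qed
  then have "\<exists>l. (\<lambda>n. ln (\<sigma> n v)) \<longlonglongrightarrow> l" if "v \<noteq> 0" for v
    using that real_Cauchy_convergent unfolding convergent_def by blast
  then obtain L where L: "(\<lambda>n. ln (\<sigma> n v)) \<longlonglongrightarrow> L v" if "v \<noteq> 0" for v
    by metis
  define \<alpha> where "\<alpha> v = (if v = 0 then 0 else exp (L v))" for v
  have lim: "(\<lambda>n. \<sigma> n v) \<longlonglongrightarrow> \<alpha> v" for v
  proof (cases "v = 0")
    case False
    then have "(\<lambda>n. exp (ln (\<sigma> n v))) \<longlonglongrightarrow> \<alpha> v"
      using L by (auto simp: \<alpha>_def intro: tendsto_exp)
    then show ?thesis using False norm_pos[OF norms] by simp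
  qed (simp add: \<alpha>_def norm_zero[OF norms])
  have \<alpha>: "is_norm absE scl \<alpha>"
    by (rule is_norm_pointwise_limit[OF norms lim]) (simp add: \<alpha>_def)
  moreover have "\<exists>N. \<forall>n\<ge>N. d_infty (\<sigma> n) \<alpha> \<le> ennreal \<epsilon>" if "\<epsilon> > 0" for \<epsilon>
  proof -
    obtain N where N: "\<forall>n\<ge>N. \<forall>m\<ge>N. \<forall>v. v \<noteq> 0 \<longrightarrow> \<bar>ln (\<sigma> n v) - ln (\<sigma> m v)\<bar> \<le> \<epsilon>"
      using ln_cauchy[OF \<open>\<epsilon> > 0\<close>] by blast
    have "\<bar>ln (\<sigma> n v) - ln (\<alpha> v)\<bar> \<le> \<epsilon>" if "n \<ge> N" "v \<noteq> 0" for n v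
    proof (rule LIMSEQ_le_const2)
      show "(\<lambda>m. \<bar>ln (\<sigma> n v) - ln (\<sigma> m v)\<bar>) \<longlonglongrightarrow> \<bar>ln (\<sigma> n v) - ln (\<alpha> v)\<bar>"
        using L[OF \<open>v \<noteq> 0\<close>] \<open>v \<noteq> 0\<close> by (auto simp: \<alpha>_def intro!: tendsto_intros)
      show "\<exists>k. \<forall>m\<ge>k. \<bar>ln (\<sigma> n v) - ln (\<sigma> m v)\<bar> \<le> \<epsilon>"
        using N that by blast
    qed
    then show ?thesis
      using d_infty_le_iff[OF norms \<alpha>] \<open>\<epsilon> > 0\<close> by (intro exI[of _ N]) auto
  qed
  ultimately show ?thesis using that by blast
qed

lemma mcomplete_component:
  assumes "is_norm absE scl \<alpha>0"
  shows "Metric_space.mcomplete (finite_distance_component absE scl \<alpha>0)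
    (\<lambda>\<alpha> \<beta>. enn2real (d_infty \<alpha> \<beta>))"
proof -
  let ?M = "finite_distance_component absE scl \<alpha>0"
  interpret M: Metric_space ?M "\<lambda>\<alpha> \<beta>. enn2real (d_infty \<alpha> \<beta>)"
    by (rule Metric_space_component[OF assms])
  note finite = d_infty_finite_in_component[OF assms]
  show ?thesis
    unfolding M.mcomplete_def
  proof (intro allI impI)
    fix \<sigma> assume "M.MCauchy \<sigma>"
    then have in_M: "\<sigma> n \<in> ?M"
      and cauchy: "\<epsilon> > 0 \<Longrightarrow> \<exists>N. \<forall>n m. N \<le> n \<longrightarrow> N \<le> m \<longrightarrow> enn2real (d_infty (\<sigma> n) (\<sigma> m)) < \<epsilon>"
      for n \<epsilon>
      by (auto simp: M.MCauchy_def)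
    have norms: "is_norm absE scl (\<sigma> n)" and \<sigma>_finite: "d_infty (\<sigma> n) \<alpha>0 < \<infinity>" for n
      using in_M[of n] by (auto simp: finite_distance_component_def)
    have le: "d_infty \<alpha> \<beta> \<le> ennreal \<epsilon>"
      if "enn2real (d_infty \<alpha> \<beta>) < \<epsilon>" "d_infty \<alpha> \<beta> < \<infinity>" for \<alpha> \<beta> :: "'v \<Rightarrow> real" and \<epsilon>
      using that by (metis ennreal_enn2real ennreal_leI infinity_ennreal_def less_imp_le)
    have "\<exists>N. \<forall>n\<ge>N. \<forall>m\<ge>N. d_infty (\<sigma> n) (\<sigma> m) \<le> ennreal \<epsilon>" if "\<epsilon> > 0" for \<epsilon>
      using cauchy[OF that] le finite[OF in_M in_M] by meson
    from uniformly_Cauchy_norms_converge[OF norms this]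
    obtain \<alpha> where \<alpha>: "is_norm absE scl \<alpha>"
      and conv: "\<And>\<epsilon>. \<epsilon> > 0 \<Longrightarrow> \<exists>N. \<forall>n\<ge>N. d_infty (\<sigma> n) \<alpha> \<le> ennreal \<epsilon>"
      by blast
    \<comment> \<open>The limit stays in the component because some \<open>\<sigma> N\<close> is within distance 1 of it.\<close>
    have "\<alpha> \<in> ?M"
    proof -
      obtain N where N: "d_infty (\<sigma> N) \<alpha> \<le> ennreal 1" using conv[of 1] by auto
      have "d_infty \<alpha> \<alpha>0 \<le> d_infty \<alpha> (\<sigma> N) + d_infty (\<sigma> N) \<alpha>0"
        by (rule d_infty_triangle[OF \<alpha> norms assms])
      also have "\<dots> < \<infinity>"
        using N \<sigma>_finite d_infty_commute[of \<alpha> \<open>\<sigma> N\<close>] by (auto simp: less_top[symmetric] top_unique)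
      finally show ?thesis using \<alpha> by (simp add: finite_distance_component_def)
    qed
    moreover have "\<exists>N. \<forall>n\<ge>N. \<sigma> n \<in> ?M \<and> enn2real (d_infty (\<sigma> n) \<alpha>) < \<epsilon>" if "\<epsilon> > 0" for \<epsilon>
    proof -
      obtain N where N: "\<forall>n\<ge>N. d_infty (\<sigma> n) \<alpha> \<le> ennreal (\<epsilon> / 2)"
        using conv[OF half_gt_zero[OF \<open>\<epsilon> > 0\<close>]] by blast
      have "enn2real (d_infty (\<sigma> n) \<alpha>) < \<epsilon>" if "n \<ge> N" for n
      proof -
        have "enn2real (d_infty (\<sigma> n) \<alpha>) \<le> \<epsilon> / 2"
          using N that \<open>\<epsilon> > 0\<close> by (intro enn2real_leI) auto
        then show ?thesis using \<open>\<epsilon> > 0\<close> by linarith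
      qed
      then show ?thesis using in_M by blast
    qed
    ultimately have "limitin M.mtopology \<sigma> \<alpha> sequentially"
      by (simp add: M.limit_metric_sequentially)
    then show "\<exists>\<alpha>. limitin M.mtopology \<sigma> \<alpha> sequentially" by blast
  qed
qed

end

theorem proposition4p1:
  fixes p :: nat
    and absQ :: "'q::field_char_0 \<Rightarrow> real"
    and absF :: "'f::field \<Rightarrow> real" and absE :: "'e::field \<Rightarrow> real"
    and \<iota>F :: "'q \<Rightarrow> 'f" and \<iota>E :: "'q \<Rightarrow> 'e"
    and P :: "('f, 'n::finite) matrix_poly set"
    and G :: "('f^'n^'n) monoid" and T :: "('f^'n^'n) topology"
    and i :: "'f \<Rightarrow> 'r::comm_ring_1" and j :: "'e alg_closure \<Rightarrow> 'r"
    and scale\<pi> :: "'e \<Rightarrow> 'w::ab_group_add \<Rightarrow> 'w" and \<pi> :: "'f^'n^'n \<Rightarrow> 'w \<Rightarrow> 'w"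
    and scale\<sigma> :: "'e \<Rightarrow> 's::ab_group_add \<Rightarrow> 's" and \<sigma> :: "'f^'n^'n \<Rightarrow> 's \<Rightarrow> 's"
    and scaleV :: "'e \<Rightarrow> 'v::ab_group_add \<Rightarrow> 'v" and \<rho> :: "'f^'n^'n \<Rightarrow> 'v \<Rightarrow> 'v"
    and t :: "'w \<Rightarrow> 's \<Rightarrow> 'v" and \<alpha>0 :: "'v \<Rightarrow> real"
  assumes "padic_numbers p absQ"
    and "finite_extension \<iota>F"
    and "nonarch_abs absF" and "\<And>x. absF (\<iota>F x) = absQ x"
    and "finite_extension \<iota>E"
    and "nonarch_abs absE" and "nontrivial_abs absE"
    and "reductive_group P"
    and "G = group_on (points P id)"
    and "T = subtopology (matrix_topology absF) (carrier G)"
    and "tensor_algebra \<iota>F (\<lambda>x. to_ac (\<iota>E x)) i j"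
    and "smooth_admissible_representation G T scale\<pi> \<pi>"
    and "algebraic_weil_representation \<iota>E i j P scale\<sigma> \<sigma>"
    and "tensor_product scale\<pi> scale\<sigma> scaleV t"
    and "group_representation G scaleV \<rho>"
    and "\<And>g w s. g \<in> carrier G \<Longrightarrow> \<rho> g (t w s) = t (\<pi> g w) (\<sigma> g s)"
    and "is_norm absE scaleV \<alpha>0"
  shows "Metric_space (finite_distance_component absE scaleV \<alpha>0) (\<lambda>\<alpha> \<beta>. enn2real (d_infty \<alpha> \<beta>)) \<and>
    Metric_space.mcomplete (finite_distance_component absE scaleV \<alpha>0)
      (\<lambda>\<alpha> \<beta>. enn2real (d_infty \<alpha> \<beta>))"
proof -
  have "vector_space scaleV"
    using \<open>tensor_product scale\<pi> scale\<sigma> scaleV t\<close> by (simp add: tensor_product_def)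
  then interpret nonarch_vector_space scaleV absE
    using \<open>nonarch_abs absE\<close>
    by (simp add: nonarch_vector_space_def nonarch_vector_space_axioms_def)
  show ?thesis
    using Metric_space_component mcomplete_component \<open>is_norm absE scaleV \<alpha>0\<close> by blast
qed

end
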